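(* The map $z\mapsto B_z$ is analytic from $\mathbb C$ into $\mathfrak F_{dist}(\mathbf 2)$.
   Context: Analytic means complex differentiable at every point, in the topology of the target space. Hermite functions: $H_n(z)=(-1)^ne^{z^2}(d/dz)^ne^{-z^2}$ and $\zeta_n(z)=\frac{1}{\pi^{1/4}2^{n/2}(n!)^{1/2}}(-1)^ne^{-z^2/2}H_n(z)$, $n=0,1,\ldots$; these are entire functions, orthonormal in $L_2(\mathbb R,dx)$. For an entire function $h$, $\int_{[w,z]}h(u)\,du$ is the complex line integral along the segment from $w$ to $z$. White noise space: $\mathscr S'_{\mathbb R}$ is the space of real tempered distributions on $\mathbb R$, $\mathcal C$ its cylinder sigma-algebra, and $P$ the probability measure (Bochner–Minlos) with $\int e^{i\langle s,\omega\rangle}dP(\omega)=e^{-\|s\|_2^2/2}$ for all real Schwartz functions $s$. $Z_n(\omega)=\langle\zeta_n,\omega\rangle$, $n=0,1,\ldots$, are independent $N(0,1)$ random variables. Let $\ell$ be the set of finitely supported sequences $\alpha=(\alpha_1,\alpha_2,\ldots)$ of non-negative integers, with $\alpha!=\prod_k\alpha_k!$. The functions $H_\alpha=\prod_{k\ge1}h_{\alpha_k}(Z_{k-1})$, where $h_n(x)=(-1)^ne^{x^2/2}(d/dx)^ne^{-x^2/2}$, form an orthogonal basis of $\mathbf L_2(\mathscr S'_{\mathbb R},\mathcal C,P)$ with $\|H_\alpha\|^2=\alpha!$. Elements $\sum_\alpha f_\alpha H_\alpha$ are identified with their coefficient families $(f_\alpha)_{\alpha\in\ell}$; in particular $Z_n$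 is identified with the family equal to $1$ at $\alpha^{(n)}$ and $0$ elsewhere, where $\alpha^{(n)}\in\ell$ has $1$ in position $n+1$ and $0$ elsewhere. Stochastic distributions: let $b_\alpha=\prod_{k\ge1}(2^k)^{\alpha_k}$. For $p=1,2,\ldots$, $\mathcal F_{-p}$ is the Hilbert space of complex families $(f_\alpha)_{\alpha\in\ell}$ with $\|f\|_{-p}^2=\sum_{\alpha\in\ell}|f_\alpha|^2b_\alpha^{-p}<\infty$, and $\mathfrak F_{dist}(\mathbf 2)=\bigcup_{p\ge1}\mathcal F_{-p}$ with the inductive limit topology. Complex Brownian motion: for $z\in\mathbb C$, $B_z=\sum_{n=0}^\infty\left(\int_{[0,z]}\zeta_n(u)\,du\right)Z_n$, i.e. the family with coefficient $\int_{[0,z]}\zeta_n(u)du$ at $\alpha^{(n)}$ ($n\ge0$) and $0$ at all other $\alpha\in\ell$. *)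

theory Defs
  imports "HOL-Complex_Analysis.Complex_Analysis" "HOL-Library.Poly_Mapping"
begin

definition hermite_poly :: "nat \<Rightarrow> complex \<Rightarrow> complex" where
  "hermite_poly n z = (-1) ^ n * exp (z\<^sup>2) * (deriv ^^ n) (\<lambda>w. exp (- (w\<^sup>2))) z"

definition hermite_fun :: "nat \<Rightarrow> complex \<Rightarrow> complex" where
  "hermite_fun n z =
     of_real (1 / (pi powr (1/4) * 2 powr (real n / 2) * sqrt (fact n)))
       * (-1) ^ n * exp (- (z\<^sup>2) / 2) * hermite_poly n z"

text \<open>
  The index set of the chaos expansion is the type \<^typ>\<open>nat \<Rightarrow>\<^sub>0 nat\<close> of finitely supported
  sequences. Positions are counted from 0 here, so that \<open>lookup \<alpha> i\<close> is the entry of \<open>\<alpha>\<close>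
  usually written with subscript \<open>i + 1\<close>. Elements \<open>\<Sum>\<^sub>\<alpha> f\<^sub>\<alpha> H\<^sub>\<alpha>\<close> are their coefficient families.
\<close>

type_synonym family = "(nat \<Rightarrow>\<^sub>0 nat) \<Rightarrow> complex"

definition weight :: "(nat \<Rightarrow>\<^sub>0 nat) \<Rightarrow> real" where
  "weight \<alpha> = (\<Prod>i\<in>Poly_Mapping.keys \<alpha>. (2 ^ (i + 1)) ^ Poly_Mapping.lookup \<alpha> i)"

text \<open>\<open>F_minus p\<close> is the Hilbert space with index \<open>-p\<close> (only \<open>p \<ge> 1\<close> is used) and
  \<open>norm_minus p\<close> its norm.\<close>

definition F_minus :: "nat \<Rightarrow> family set" where
  "F_minus p = {f. (\<lambda>\<alpha>. (cmod (f \<alpha>))\<^sup>2 / weight \<alpha> ^ p) summable_on UNIV}"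

definition norm_minus :: "nat \<Rightarrow> family \<Rightarrow> real" where
  "norm_minus p f = sqrt (\<Sum>\<^sub>\<infinity>\<alpha>. (cmod (f \<alpha>))\<^sup>2 / weight \<alpha> ^ p)"

definition F_dist :: "family set" where
  "F_dist = (\<Union>p\<in>{1..}. F_minus p)"

text \<open>
  The inductive limit topology is the finest locally convex topology on \<^term>\<open>F_dist\<close> for which
  all inclusions of the spaces \<^term>\<open>F_minus p\<close> are continuous. Its zero neighbourhood base
  consists of the convex sets whose trace on each step is a neighbourhood of zero there.
  (The inclusion of each step in the next is compact, so the finest topology, locally convex or
  not, that makes the inclusions continuous is the same one.)
\<close>

definition basic_zero_nhd :: "family set \<Rightarrow> bool" where
  "basic_zero_nhd V \<longleftrightarrow>
     V \<subseteq> F_dist \<and>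
     (\<forall>f\<in>V. \<forall>g\<in>V. \<forall>t\<in>{0..1::real}.
        (\<lambda>\<alpha>. of_real (1 - t) * f \<alpha> + of_real t * g \<alpha>) \<in> V) \<and>
     (\<forall>p\<ge>1. \<exists>\<epsilon>>0. {f \<in> F_minus p. norm_minus p f < \<epsilon>} \<subseteq> V)"

definition F_dist_topology :: "family topology" where
  "F_dist_topology = topology (\<lambda>U. U \<subseteq> F_dist \<and>
     (\<forall>f\<in>U. \<exists>V. basic_zero_nhd V \<and> (\<forall>g\<in>V. (\<lambda>\<alpha>. f \<alpha> + g \<alpha>) \<in> U)))"

lemma basic_zero_nhd_Int:
  assumes "basic_zero_nhd V" "basic_zero_nhd W"
  shows "basic_zero_nhd (V \<inter> W)"
  unfolding basic_zero_nhd_def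
proof (intro conjI allI impI)
  show "V \<inter> W \<subseteq> F_dist"
    using assms by (auto simp: basic_zero_nhd_def)
  show "\<forall>f\<in>V \<inter> W. \<forall>g\<in>V \<inter> W. \<forall>t\<in>{0..1::real}.
        (\<lambda>\<alpha>. of_real (1 - t) * f \<alpha> + of_real t * g \<alpha>) \<in> V \<inter> W"
    using assms unfolding basic_zero_nhd_def by blast
  fix p :: nat assume "p \<ge> 1"
  then obtain d e where "d > 0" "{f \<in> F_minus p. norm_minus p f < d} \<subseteq> V"
      "e > 0" "{f \<in> F_minus p. norm_minus p f < e} \<subseteq> W"
    using assms unfolding basic_zero_nhd_def by meson
  then show "\<exists>\<epsilon>>0. {f \<in> F_minus p. norm_minus p f < \<epsilon>} \<subseteq> V \<inter> W"
    by (intro exI[of _ "min d e"]) auto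
qed

lemma openin_F_dist_topology:
  "openin F_dist_topology U \<longleftrightarrow> U \<subseteq> F_dist \<and>
     (\<forall>f\<in>U. \<exists>V. basic_zero_nhd V \<and> (\<forall>g\<in>V. (\<lambda>\<alpha>. f \<alpha> + g \<alpha>) \<in> U))"
proof -
  have "istopology (\<lambda>U. U \<subseteq> F_dist \<and>
     (\<forall>f\<in>U. \<exists>V. basic_zero_nhd V \<and> (\<forall>g\<in>V. (\<lambda>\<alpha>. f \<alpha> + g \<alpha>) \<in> U)))" (is "istopology ?P")
    unfolding istopology_def
  proof (intro conjI allI impI)
    fix S T assume S: "?P S" and T: "?P T"
    show "S \<inter> T \<subseteq> F_dist" using S by blast
    show "\<forall>f\<in>S \<inter> T. \<exists>V. basic_zero_nhd V \<and> (\<forall>g\<in>V. (\<lambda>\<alpha>. f \<alpha> + g \<alpha>) \<in> S \<inter> T)"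
    proof
      fix f assume "f \<in> S \<inter> T"
      then obtain V W where "basic_zero_nhd V" "\<forall>g\<in>V. (\<lambda>\<alpha>. f \<alpha> + g \<alpha>) \<in> S"
          "basic_zero_nhd W" "\<forall>g\<in>W. (\<lambda>\<alpha>. f \<alpha> + g \<alpha>) \<in> T"
        using S T by blast
      then show "\<exists>V. basic_zero_nhd V \<and> (\<forall>g\<in>V. (\<lambda>\<alpha>. f \<alpha> + g \<alpha>) \<in> S \<inter> T)"
        by (intro exI[of _ "V \<inter> W"]) (auto intro: basic_zero_nhd_Int)
    qed
  next
    fix K assume K: "\<forall>U\<in>K. ?P U"
    then show "\<Union>K \<subseteq> F_dist" by blast
    show "\<forall>f\<in>\<Union>K. \<exists>V. basic_zero_nhd V \<and> (\<forall>g\<in>V. (\<lambda>\<alpha>. f \<alpha> + g \<alpha>) \<in> \<Union>K)"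
      using K by (meson UnionE UnionI)
  qed
  then show ?thesis
    unfolding F_dist_topology_def by (simp add: topology_inverse')
qed

lemma weight_ge_1: "weight \<alpha> \<ge> 1"
  unfolding weight_def by (intro prod_ge_1 one_le_power) auto

lemma F_minus_mono:
  assumes "p \<le> q"
  shows "F_minus p \<subseteq> F_minus q"
proof
  fix f assume "f \<in> F_minus p"
  then have s: "(\<lambda>\<alpha>. (cmod (f \<alpha>))\<^sup>2 / weight \<alpha> ^ p) summable_on UNIV"
    by (simp add: F_minus_def)
  have "(\<lambda>\<alpha>. (cmod (f \<alpha>))\<^sup>2 / weight \<alpha> ^ q) summable_on UNIV"
  proof (rule summable_on_comparison_test[OF s])
    fix \<alpha>
    have w: "weight \<alpha> \<ge> 1" by (rule weight_ge_1)
    then show "(cmod (f \<alpha>))\<^sup>2 / weight \<alpha> ^ q \<le> (cmod (f \<alpha>))\<^sup>2 / weight \<alpha> ^ p"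
      using assms by (intro divide_left_mono power_increasing mult_pos_pos zero_less_power) auto
    show "0 \<le> (cmod (f \<alpha>))\<^sup>2 / weight \<alpha> ^ q"
      using w by simp
  qed
  then show "f \<in> F_minus q" by (simp add: F_minus_def)
qed

lemma F_minus_scale:
  assumes "f \<in> F_minus p"
  shows "(\<lambda>\<alpha>. c * f \<alpha>) \<in> F_minus p"
  using summable_on_cmult_right[of "\<lambda>\<alpha>. (cmod (f \<alpha>))\<^sup>2 / weight \<alpha> ^ p" UNIV "(cmod c)\<^sup>2"] assms
  by (simp add: F_minus_def norm_mult power_mult_distrib)

lemma F_minus_add:
  assumes "f \<in> F_minus p" "g \<in> F_minus p"
  shows "(\<lambda>\<alpha>. f \<alpha> + g \<alpha>) \<in> F_minus p"
proof -
  have s: "(\<lambda>\<alpha>. 2 * ((cmod (f \<alpha>))\<^sup>2 / weight \<alpha> ^ p) + 2 * ((cmod (g \<alpha>))\<^sup>2 / weight \<alpha> ^ p))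
      summable_on UNIV"
    using assms by (intro summable_on_add summable_on_cmult_right) (auto simp: F_minus_def)
  have "(\<lambda>\<alpha>. (cmod (f \<alpha> + g \<alpha>))\<^sup>2 / weight \<alpha> ^ p) summable_on UNIV"
  proof (rule summable_on_comparison_test[OF s])
    fix \<alpha>
    have w: "weight \<alpha> \<ge> 1" by (rule weight_ge_1)
    have "(cmod (f \<alpha> + g \<alpha>))\<^sup>2 \<le> (cmod (f \<alpha>) + cmod (g \<alpha>))\<^sup>2"
      by (intro power_mono norm_triangle_ineq) auto
    also have "\<dots> \<le> 2 * (cmod (f \<alpha>))\<^sup>2 + 2 * (cmod (g \<alpha>))\<^sup>2"
      using sum_squares_bound[of "cmod (f \<alpha>)" "cmod (g \<alpha>)"] by (simp add: power2_sum)
    finally have "(cmod (f \<alpha> + g \<alpha>))\<^sup>2 / weight \<alpha> ^ p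
        \<le> (2 * (cmod (f \<alpha>))\<^sup>2 + 2 * (cmod (g \<alpha>))\<^sup>2) / weight \<alpha> ^ p"
      using w by (intro divide_right_mono) auto
    then show "(cmod (f \<alpha> + g \<alpha>))\<^sup>2 / weight \<alpha> ^ p
        \<le> 2 * ((cmod (f \<alpha>))\<^sup>2 / weight \<alpha> ^ p) + 2 * ((cmod (g \<alpha>))\<^sup>2 / weight \<alpha> ^ p)"
      by (simp add: add_divide_distrib)
    show "0 \<le> (cmod (f \<alpha> + g \<alpha>))\<^sup>2 / weight \<alpha> ^ p"
      using w by simp
  qed
  then show ?thesis by (simp add: F_minus_def)
qed

lemma F_dist_scale: "f \<in> F_dist \<Longrightarrow> (\<lambda>\<alpha>. c * f \<alpha>) \<in> F_dist"
  unfolding F_dist_def using F_minus_scale by blast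

lemma F_dist_add:
  assumes "f \<in> F_dist" "g \<in> F_dist"
  shows "(\<lambda>\<alpha>. f \<alpha> + g \<alpha>) \<in> F_dist"
proof -
  obtain p q where pq: "p \<ge> 1" "f \<in> F_minus p" "q \<ge> 1" "g \<in> F_minus q"
    using assms by (auto simp: F_dist_def)
  then have "f \<in> F_minus (max p q)" "g \<in> F_minus (max p q)"
    using F_minus_mono[of p "max p q"] F_minus_mono[of q "max p q"] by auto
  then show ?thesis
    using F_minus_add[of f "max p q" g] pq unfolding F_dist_def by force
qed

lemma basic_zero_nhd_F_dist: "basic_zero_nhd F_dist"
  unfolding basic_zero_nhd_def
proof (intro conjI allI impI ballI)
  fix p :: nat assume "p \<ge> 1"
  then show "\<exists>\<epsilon>>0. {f \<in> F_minus p. norm_minus p f < \<epsilon>} \<subseteq> F_dist"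
    by (intro exI[of _ 1]) (auto simp: F_dist_def)
qed (auto intro!: F_dist_add F_dist_scale)

lemma topspace_F_dist_topology [simp]: "topspace F_dist_topology = F_dist"
proof
  show "topspace F_dist_topology \<subseteq> F_dist"
    using openin_F_dist_topology openin_topspace by blast
  have "openin F_dist_topology F_dist"
    unfolding openin_F_dist_topology using basic_zero_nhd_F_dist F_dist_add by blast
  then show "F_dist \<subseteq> topspace F_dist_topology"
    by (rule openin_subset)
qed

text \<open>Analyticity of a map on the complex plane with values in a topologized space of families:
  the difference quotients converge, in the given topology, at every point.\<close>

definition analytic_into :: "('i \<Rightarrow> complex) topology \<Rightarrow> (complex \<Rightarrow> 'i \<Rightarrow> complex) \<Rightarrow> bool" where
  "analytic_into X f \<longleftrightarrow>
     (\<forall>z. f z \<in> topspace X) \<and>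
     (\<forall>z. \<exists>D. limitin X (\<lambda>w \<alpha>. (f w \<alpha> - f z \<alpha>) / (w - z)) D (at z))"

text \<open>\<open>unit_index n\<close> is the index of the random variable \<open>Z\<^sub>n\<close>.\<close>

definition unit_index :: "nat \<Rightarrow> (nat \<Rightarrow>\<^sub>0 nat)" where
  "unit_index n = Poly_Mapping.single n 1"

definition brownian :: "complex \<Rightarrow> family" where
  "brownian z \<alpha> =
     (if \<exists>n. \<alpha> = unit_index n
      then contour_integral (linepath 0 z) (hermite_fun (THE n. \<alpha> = unit_index n))
      else 0)"

lemma unit_index_inject [simp]: "unit_index m = unit_index n \<longleftrightarrow> m = n"
  unfolding unit_index_def by (metis Poly_Mapping.keys_single one_neq_zero singleton_inject)

lemma brownian_unit_index:
  "brownian z (unit_index n) = contour_integral (linepath 0 z) (hermite_fun n)"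
  unfolding brownian_def by simp

lemma brownian_eq_0: "\<alpha> \<notin> range unit_index \<Longrightarrow> brownian z \<alpha> = 0"
  unfolding brownian_def by auto

end

theory Submission imports Defs
begin

text \<open>
  Cauchy's inequality for the Gaussian on a circle of radius \<open>sqrt (n + 1)\<close> shows that on every
  disc \<open>\<bar>\<zeta>\<^sub>n(z)\<bar> \<le> C 8\<^sup>n\<close>. Since the weight of the index of \<open>Z\<^sub>n\<close> is \<open>2\<^sup>n\<^sup>+\<^sup>1\<close>, families with
  coefficients of this size lie in the single step of index 7. There the difference quotients of
  \<open>B\<close> at \<open>z\<close> converge in norm to the family with coefficients \<open>\<zeta>\<^sub>n(z)\<close>, the error being
  \<open>O(\<bar>w - z\<bar>)\<close> because \<open>\<zeta>\<^sub>n'\<close> obeys the same bound.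
\<close>

section \<open>Growth of the Hermite functions on discs\<close>

lemma hermite_fun_holomorphic: "hermite_fun n holomorphic_on A"
proof -
  have "hermite_fun n holomorphic_on UNIV"
    unfolding hermite_fun_def [abs_def] hermite_poly_def by (intro holomorphic_intros) auto
  then show ?thesis
    by (rule holomorphic_on_subset) simp
qed

text \<open>The two signs cancel and the exponential prefactors merge, leaving a derivative of the
  Gaussian as the only factor that takes work to estimate.\<close>

lemma hermite_fun_eq:
  "hermite_fun n z =
     of_real (1 / (pi powr (1/4) * 2 powr (real n / 2) * sqrt (fact n)))
       * exp (z\<^sup>2 / 2) * (deriv ^^ n) (\<lambda>w. exp (- (w\<^sup>2))) z"
proof -
  have s: "(-1) ^ n * (-1) ^ n = (1::complex)"
    by (simp flip: power_mult_distrib)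
  have e: "exp (- (z\<^sup>2) / 2) * exp (z\<^sup>2) = exp (z\<^sup>2 / 2)"
    by (simp flip: exp_add)
  have "hermite_fun n z =
      of_real (1 / (pi powr (1/4) * 2 powr (real n / 2) * sqrt (fact n)))
       * ((-1) ^ n * (-1) ^ n) * (exp (- (z\<^sup>2) / 2) * exp (z\<^sup>2))
       * (deriv ^^ n) (\<lambda>w. exp (- (w\<^sup>2))) z"
    by (simp add: hermite_fun_def hermite_poly_def mult_ac)
  then show ?thesis
    unfolding s e by simp
qed

lemma cmod_exp_le: "cmod (exp z) \<le> exp (cmod z)"
  by (metis complex_Re_le_cmod exp_le_cancel_iff norm_exp_eq_Re)

lemma higher_deriv_gaussian_bound:
  assumes "cmod z \<le> R"
  shows "cmod ((deriv ^^ n) (\<lambda>w. exp (- (w\<^sup>2))) z)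
    \<le> fact n * exp (2 * R\<^sup>2 + 2 * (real n + 1)) / sqrt ((real n + 1) ^ n)"
proof -
  \<comment> \<open>This radius balances Cauchy's inequality: on the circle the Gaussian costs a
    factor \<open>exp (2 * r^2)\<close>, merely geometric in \<open>n\<close>, while
    \<open>r ^ n\<close> is at least \<open>sqrt (fact n)\<close>. The summand 1 keeps the radius
    positive at \<open>n = 0\<close>.\<close>
  define r where "r = sqrt (real n + 1)"
  have r: "r > 0" "r\<^sup>2 = real n + 1"
    by (auto simp: r_def)
  have "cmod ((deriv ^^ n) (\<lambda>w. exp (- (w\<^sup>2))) z)
      \<le> fact n * exp (2 * R\<^sup>2 + 2 * (real n + 1)) / r ^ n"
  proof (rule Cauchy_inequality)
    fix x :: complex assume x: "cmod (z - x) = r"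
    have "cmod x \<le> cmod z + cmod (z - x)"
      by (metis add.commute norm_minus_commute norm_triangle_sub)
    then have "cmod x \<le> R + r"
      using assms x by simp
    then have "(cmod x)\<^sup>2 \<le> (R + r)\<^sup>2"
      by (intro power_mono) auto
    also have "\<dots> \<le> 2 * R\<^sup>2 + 2 * r\<^sup>2"
      using sum_squares_bound [of R r] by (simp add: power2_sum)
    finally have "cmod (- (x\<^sup>2)) \<le> 2 * R\<^sup>2 + 2 * (real n + 1)"
      unfolding r by (simp add: norm_power)
    then show "cmod (exp (- (x\<^sup>2))) \<le> exp (2 * R\<^sup>2 + 2 * (real n + 1))"
      using cmod_exp_le [of "- (x\<^sup>2)"] exp_le_cancel_iff order.trans by blast
  qed (auto intro!: holomorphic_intros continuous_intros r)
  then show ?thesis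
    by (simp add: r_def real_sqrt_power)
qed

text \<open>The factorial from Cauchy's inequality disappears: one factor
  \<open>sqrt (fact n)\<close> is absorbed by the normalising constant, the other by
  \<open>(n + 1) ^ n \<ge> fact n\<close>. Only \<open>exp 2 ^ n\<close> remains, times a constant
  depending on the disc alone.\<close>

lemma hermite_fun_bound:
  assumes "cmod z \<le> R"
  shows "cmod (hermite_fun n z) \<le> exp (3 * R\<^sup>2 + 2) * 8 ^ n"
proof -
  let ?c = "pi powr (1/4) * 2 powr (real n / 2) * sqrt (fact n)"
  let ?E = "exp (2 * R\<^sup>2 + 2 * (real n + 1))"
  have R: "(cmod z)\<^sup>2 \<le> R\<^sup>2"
    using assms by (intro power_mono) auto
  have c: "sqrt (fact n) \<le> ?c"
  proof -
    have "1 \<le> pi powr (1/4)" "1 \<le> 2 powr (real n / 2)"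
      using pi_gt3 by (auto intro!: ge_one_powr_ge_zero)
    then have "1 * 1 \<le> pi powr (1/4) * 2 powr (real n / 2)"
      by (intro mult_mono) auto
    then show ?thesis
      using mult_right_mono [of 1 "pi powr (1/4) * 2 powr (real n / 2)" "sqrt (fact n)"] by simp
  qed
  have f: "sqrt (fact n) \<le> sqrt ((real n + 1) ^ n)"
  proof -
    have "(fact n :: real) \<le> real n ^ n"
      using fact_le_power [of n, where 'a = real] by simp
    also have "\<dots> \<le> (real n + 1) ^ n"
      by (intro power_mono) auto
    finally show ?thesis
      by simp
  qed
  have "cmod (hermite_fun n z) = 1 / ?c * cmod (exp (z\<^sup>2 / 2)) *
      cmod ((deriv ^^ n) (\<lambda>w. exp (- (w\<^sup>2))) z)"
    unfolding hermite_fun_eq norm_mult norm_of_real by simp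
  also have "\<dots> \<le> 1 / sqrt (fact n) * exp (R\<^sup>2) * (fact n * ?E / sqrt (fact n))"
  proof (intro mult_mono)
    show "1 / ?c \<le> 1 / sqrt (fact n)"
      using c by (intro divide_left_mono) (auto intro!: mult_pos_pos)
    have "cmod (z\<^sup>2 / 2) \<le> R\<^sup>2"
      using R by (simp add: norm_divide norm_power) (smt (verit) zero_le_power2)
    then show "cmod (exp (z\<^sup>2 / 2)) \<le> exp (R\<^sup>2)"
      using cmod_exp_le [of "z\<^sup>2 / 2"] exp_le_cancel_iff order.trans by blast
    have "fact n * ?E / sqrt ((real n + 1) ^ n) \<le> fact n * ?E / sqrt (fact n)"
      using f by (intro divide_left_mono) (auto intro!: mult_pos_pos)
    then show "cmod ((deriv ^^ n) (\<lambda>w. exp (- (w\<^sup>2))) z) \<le> fact n * ?E / sqrt (fact n)"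
      using higher_deriv_gaussian_bound [OF assms, of n] by linarith
  qed auto
  also have "\<dots> = exp (R\<^sup>2) * ?E"
    by (simp add: field_simps)
  also have "\<dots> = exp (3 * R\<^sup>2 + 2) * exp 2 ^ n"
    by (simp add: algebra_simps flip: exp_add exp_of_nat_mult)
  also have "\<dots> \<le> exp (3 * R\<^sup>2 + 2) * 8 ^ n"
  proof (intro mult_left_mono power_mono)
    \<comment> \<open>Since e < 2.72, the square of e is below 7.4; rounding up to 8, a power of
      two, makes the later comparison with the weights a plain geometric series.\<close>
    have "exp (2::real) = exp 1 * exp 1"
      by (simp flip: exp_add)
    also have "\<dots> \<le> 272/100 * (272/100)"
      using e_less_272 by (intro mult_mono) auto
    finally show "exp (2::real) \<le> 8"
      by simp
  qed auto
  finally show ?thesis .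
qed

section \<open>Families supported on the indices of the \<open>Z_n\<close>\<close>

lemma weight_unit_index: "weight (unit_index n) = 2 ^ (n + 1)"
  by (simp add: weight_def unit_index_def)

text \<open>The term at \<open>unit_index n\<close> is at most
  \<open>M^2 * 64^n / 128^(n+1)\<close>, a geometric series of ratio 1/2; 7 is the least exponent p
  with \<open>2^p > 64\<close>. Linearity in \<open>M\<close> lets a small \<open>M\<close> give a
  small norm.\<close>

lemma
  assumes supp: "\<And>\<alpha>. \<alpha> \<notin> range unit_index \<Longrightarrow> f \<alpha> = 0"
    and bound: "\<And>n. cmod (f (unit_index n)) \<le> M * 8 ^ n"
  shows F_minus_7I: "f \<in> F_minus 7"
    and norm_minus_7_le: "norm_minus 7 f \<le> M"
proof -
  let ?g = "\<lambda>\<alpha>. (cmod (f \<alpha>))\<^sup>2 / weight \<alpha> ^ 7"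
  have M: "M \<ge> 0"
    using order.trans [OF norm_ge_zero bound [of 0]] by simp
  have inj: "inj unit_index"
    by (auto intro: injI)
  have "((\<lambda>n. M\<^sup>2 / 128 * (1/2) ^ n) sums (M\<^sup>2 / 128 * (1 / (1 - 1/2))))"
    by (intro sums_mult geometric_sums) auto
  then have hs: "((\<lambda>n. M\<^sup>2 / 128 * (1/2) ^ n) has_sum (M\<^sup>2 / 64)) UNIV"
    by (intro sums_nonneg_imp_has_sum) auto
  have le: "(?g \<circ> unit_index) n \<le> M\<^sup>2 / 128 * (1/2) ^ n" for n
  proof -
    have "(cmod (f (unit_index n)))\<^sup>2 \<le> (M * 8 ^ n)\<^sup>2"
      by (intro power_mono bound) auto
    then have "(?g \<circ> unit_index) n \<le> (M * 8 ^ n)\<^sup>2 / (2 ^ (n + 1)) ^ 7"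
      by (simp add: weight_unit_index divide_right_mono)
    also have "\<dots> = M\<^sup>2 * 64 ^ n / (128 * 128 ^ n)"
    proof -
      have "(8 ^ n)\<^sup>2 = ((8::real)\<^sup>2) ^ n" "(2 ^ n) ^ 7 = ((2::real) ^ 7) ^ n"
        by (simp_all only: mult.commute flip: power_mult)
      then show ?thesis
        by (simp add: power_mult_distrib)
    qed
    also have "\<dots> = M\<^sup>2 / 128 * (64 / 128) ^ n"
      by (simp only: power_divide) simp
    finally show ?thesis
      by simp
  qed
  have "(?g \<circ> unit_index) summable_on UNIV"
    by (rule summable_on_comparison_test [OF has_sum_imp_summable [OF hs] le])
      (use weight_ge_1 in \<open>simp add: weight_unit_index\<close>)
  \<comment> \<open>Terms off the range of \<open>unit_index\<close> vanish, so injectivity turns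
    the sum over all indices into a sum over \<open>n\<close>.\<close>
  moreover have "infsum ?g UNIV = infsum ?g (range unit_index)"
    by (rule infsum_cong_neutral) (use supp in auto)
  moreover have "?g summable_on UNIV \<longleftrightarrow> ?g summable_on (range unit_index)"
    by (rule summable_on_cong_neutral) (use supp in auto)
  ultimately have s: "?g summable_on UNIV"
    and i: "infsum ?g UNIV = infsum (?g \<circ> unit_index) UNIV"
    and s': "(?g \<circ> unit_index) summable_on UNIV"
    using inj by (auto simp: summable_on_reindex infsum_reindex)
  show "f \<in> F_minus 7"
    using s by (simp add: F_minus_def)
  have "infsum ?g UNIV \<le> M\<^sup>2 / 64"
    unfolding i infsumI [OF hs, symmetric] by (intro infsum_mono s' has_sum_imp_summable [OF hs] le)
  also have "\<dots> \<le> M\<^sup>2"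
    by simp
  finally show "norm_minus 7 f \<le> M"
    unfolding norm_minus_def using M by (simp add: real_le_lsqrt)
qed

section \<open>Difference quotients of segment integrals of entire functions\<close>

lemma entire_primitive:
  assumes "f holomorphic_on UNIV"
  obtains F where "\<And>z. (F has_field_derivative f z) (at z)"
    "\<And>a b. contour_integral (linepath a b) f = F b - F a"
proof -
  obtain F where F: "\<And>z. (F has_field_derivative f z) (at z)"
    using holomorphic_convex_primitive [OF convex_UNIV finite.emptyI, of f] assms
    by (auto simp: holomorphic_on_imp_continuous_on holomorphic_on_open field_differentiable_def)
  show thesis
  proof (rule that [OF F])
    show "contour_integral (linepath a b) f = F b - F a" for a b
      using contour_integral_primitive [OF has_field_derivative_at_within [OF F], where S = UNIV
          and g = "linepath a b"]
      by (auto intro: contour_integral_unique)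
  qed
qed

text \<open>A first-order Taylor estimate for a primitive, with an error linear in \<open>M\<close>,
  so that it keeps the geometric growth in \<open>n\<close> when applied to every Hermite function
  at once.\<close>

lemma entire_difference_quotient_bound:
  assumes f: "f holomorphic_on UNIV"
    and M: "\<And>u. u \<in> cball z 2 \<Longrightarrow> cmod (f u) \<le> M"
    and w: "w \<in> cball z 1" "w \<noteq> z"
  shows "cmod ((contour_integral (linepath 0 w) f - contour_integral (linepath 0 z) f) / (w - z) - f z)
    \<le> M * cmod (w - z)"
proof -
  have "M \<ge> 0"
    using M [of z] norm_ge_zero [of "f z"] by (simp del: norm_ge_zero)
  have f': "(f has_field_derivative deriv f u) (at u within S)" for u S
    using f by (meson UNIV_I has_field_derivative_at_within holomorphic_derivI open_UNIV)
  \<comment> \<open>Unit circles around points of \<open>cball z 1\<close> stay in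
    \<open>cball z 2\<close>, so Cauchy's inequality with radius 1 passes the bound \<open>M\<close>
    on to the derivative.\<close>
  have d: "cmod (deriv f u) \<le> M" if "u \<in> cball z 1" for u
  proof -
    have "cmod ((deriv ^^ 1) f u) \<le> fact 1 * M / 1 ^ 1"
    proof (rule Cauchy_inequality)
      fix x assume "cmod (u - x) = 1"
      then show "cmod (f x) \<le> M"
        using that dist_triangle [of z x u] by (intro M) (simp add: dist_norm)
    qed (use f in \<open>auto intro: holomorphic_on_subset holomorphic_on_imp_continuous_on\<close>)
    then show ?thesis
      by simp
  qed
  have seg: "closed_segment z w \<subseteq> cball z 1"
    using w by (intro closed_segment_subset) auto
  have osc: "cmod (f u - f z) \<le> M * cmod (w - z)" if "u \<in> closed_segment z w" for u
  proof -
    have "cmod (f u - f z) \<le> M * cmod (u - z)"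
      using that seg by (intro field_differentiable_bound [OF convex_cball f' d]) auto
    also have "\<dots> \<le> M * cmod (w - z)"
      using segment_bound(1) [OF that] \<open>M \<ge> 0\<close> by (intro mult_left_mono) auto
    finally show ?thesis .
  qed
  \<comment> \<open>With a primitive the base point 0 cancels, and the difference of the two
    integrals is \<open>F w - F z\<close>.\<close>
  obtain F where F: "\<And>u. (F has_field_derivative f u) (at u)"
    and ci: "\<And>a b. contour_integral (linepath a b) f = F b - F a"
    using entire_primitive [OF f] by metis
  \<comment> \<open>Mean value inequality for \<open>F u - f z * u\<close>, whose derivative
    \<open>f u - f z\<close> is controlled by \<open>osc\<close> on the segment.\<close>
  have "cmod ((F w - f z * w) - (F z - f z * z)) \<le> (M * cmod (w - z)) * cmod (w - z)"
    by (rule field_differentiable_bound [where S = "closed_segment z w" and f' = "\<lambda>u. f u - f z"])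
      (auto intro!: osc derivative_eq_intros has_field_derivative_at_within [OF F])
  then have "cmod ((F w - F z) - f z * (w - z)) / cmod (w - z) \<le> M * cmod (w - z)"
    using w by (simp add: divide_le_eq algebra_simps)
  moreover have "(F w - F z) / (w - z) - f z = ((F w - F z) - f z * (w - z)) / (w - z)"
    using w by (simp add: field_simps)
  ultimately show ?thesis
    unfolding ci by (simp add: norm_divide)
qed

section \<open>Complex Brownian motion and its derivative\<close>

lemma brownian_F_dist: "brownian z \<in> F_dist"
proof -
  let ?C = "exp (3 * (cmod z)\<^sup>2 + 2) * cmod z"
  have "brownian z \<in> F_minus 7"
  proof (rule F_minus_7I [where M = ?C])
    show "cmod (brownian z (unit_index n)) \<le> ?C * 8 ^ n" for n
    proof -
      \<comment> \<open>Length of the segment times the bound on the disc of radius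
        \<open>cmod z\<close> containing it.\<close>
      have "cmod (contour_integral (linepath 0 z) (hermite_fun n))
          \<le> exp (3 * (cmod z)\<^sup>2 + 2) * 8 ^ n * cmod (z - 0)"
      proof (rule contour_integral_bound_linepath)
        show "hermite_fun n contour_integrable_on linepath 0 z"
          by (intro contour_integrable_continuous_linepath holomorphic_on_imp_continuous_on
              hermite_fun_holomorphic)
        show "cmod (hermite_fun n x) \<le> exp (3 * (cmod z)\<^sup>2 + 2) * 8 ^ n"
          if "x \<in> closed_segment 0 z" for x
          using segment_bound(1) [OF that] by (intro hermite_fun_bound) simp
      qed auto
      then show ?thesis
        by (simp add: brownian_unit_index mult_ac)
    qed
  qed (rule brownian_eq_0)
  then show ?thesis
    unfolding F_dist_def by force
qed

text \<open>The candidate derivative, white noise at \<open>z\<close>, obtained by differentiating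
  each coefficient integral. The guard is there because \<open>inv unit_index\<close> is unspecified
  off the range.\<close>

definition brownian_deriv :: "complex \<Rightarrow> family" where
  "brownian_deriv z \<alpha> =
     (if \<alpha> \<in> range unit_index then hermite_fun (inv unit_index \<alpha>) z else 0)"

lemma brownian_deriv_unit_index [simp]: "brownian_deriv z (unit_index n) = hermite_fun n z"
  by (simp add: brownian_deriv_def inv_f_f inj_def)

lemma brownian_deriv_F_dist: "brownian_deriv z \<in> F_dist"
proof -
  have "brownian_deriv z \<in> F_minus 7"
    by (rule F_minus_7I [where M = "exp (3 * (cmod z)\<^sup>2 + 2)"])
      (auto simp: brownian_deriv_def inv_f_f inj_def intro: hermite_fun_bound)
  then show ?thesis
    unfolding F_dist_def by force
qed

text \<open>Every basic zero neighbourhood contains a ball of each step, so norm convergence of the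
  errors within one fixed step implies convergence in the inductive limit.\<close>

lemma limitin_F_dist_stepI:
  assumes "D \<in> F_dist" "p \<ge> 1"
    and mem: "eventually (\<lambda>w. (\<lambda>\<alpha>. f w \<alpha> - D \<alpha>) \<in> F_minus p) F"
    and lim: "((\<lambda>w. norm_minus p (\<lambda>\<alpha>. f w \<alpha> - D \<alpha>)) \<longlongrightarrow> 0) F"
  shows "limitin F_dist_topology f D F"
  unfolding limitin_def
proof (intro conjI allI impI)
  fix U assume "openin F_dist_topology U \<and> D \<in> U"
  then obtain V where V: "basic_zero_nhd V" "\<And>g. g \<in> V \<Longrightarrow> (\<lambda>\<alpha>. D \<alpha> + g \<alpha>) \<in> U"
    unfolding openin_F_dist_topology by blast
  obtain e where e: "e > 0" "{g \<in> F_minus p. norm_minus p g < e} \<subseteq> V"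
    using V(1) \<open>p \<ge> 1\<close> unfolding basic_zero_nhd_def by blast
  have "eventually (\<lambda>w. norm_minus p (\<lambda>\<alpha>. f w \<alpha> - D \<alpha>) < e) F"
    using order_tendstoD(2) [OF lim e(1)] .
  with mem show "eventually (\<lambda>w. f w \<in> U) F"
  proof eventually_elim
    case (elim w)
    then show ?case
      using V(2) [of "\<lambda>\<alpha>. f w \<alpha> - D \<alpha>"] e(2) by auto
  qed
qed (use assms in simp)

theorem theorem6p4: "analytic_into F_dist_topology brownian"
  unfolding analytic_into_def
proof (intro conjI allI exI)
  fix z :: complex
  show "brownian z \<in> topspace F_dist_topology"
    by (simp add: brownian_F_dist)
  \<comment> \<open>The constant of \<open>hermite_fun_bound\<close> for radius
    \<open>cmod z + 2\<close>, since the quotient estimate needs a bound on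
    \<open>cball z 2\<close>.\<close>
  define C where "C = exp (3 * (cmod z + 2)\<^sup>2 + 2)"
  let ?err = "\<lambda>w \<alpha>. (brownian w \<alpha> - brownian z \<alpha>) / (w - z) - brownian_deriv z \<alpha>"
  have supp: "?err w \<alpha> = 0" if "\<alpha> \<notin> range unit_index" for w \<alpha>
    using that by (simp add: brownian_eq_0 brownian_deriv_def)
  have bound: "cmod (?err w (unit_index n)) \<le> C * cmod (w - z) * 8 ^ n"
    if "w \<in> cball z 1" "w \<noteq> z" for w n
  proof -
    have "cmod (hermite_fun n u) \<le> C * 8 ^ n" if "u \<in> cball z 2" for u
      unfolding C_def
      using that norm_triangle_sub [of u z]
      by (intro hermite_fun_bound) (simp add: dist_norm norm_minus_commute)
    from entire_difference_quotient_bound [OF hermite_fun_holomorphic this \<open>w \<in> cball z 1\<close> \<open>w \<noteq> z\<close>]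
    show ?thesis
      by (simp add: brownian_unit_index mult_ac)
  qed
  have near: "eventually (\<lambda>w. w \<in> cball z 1 \<and> w \<noteq> z) (at z)"
    unfolding eventually_at by (intro exI [of _ 1]) (auto simp: dist_commute)
  show "limitin F_dist_topology (\<lambda>w \<alpha>. (brownian w \<alpha> - brownian z \<alpha>) / (w - z))
      (brownian_deriv z) (at z)"
  \<comment> \<open>Step 7 serves every \<open>z\<close>: the disc affects the constant
    \<open>C\<close> but not the growth rate \<open>8 ^ n\<close>.\<close>
  proof (rule limitin_F_dist_stepI [OF brownian_deriv_F_dist, of 7])
    show "eventually (\<lambda>w. ?err w \<in> F_minus 7) (at z)"
      using near by eventually_elim (rule F_minus_7I [OF supp bound], auto)
    show "((\<lambda>w. norm_minus 7 (?err w)) \<longlongrightarrow> 0) (at z)"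
    proof (rule tendsto_sandwich)
      show "eventually (\<lambda>w. 0 \<le> norm_minus 7 (?err w)) (at z)"
        using weight_ge_1
        by (intro always_eventually allI)
          (auto simp: norm_minus_def intro!: infsum_nonneg divide_nonneg_nonneg zero_le_power
            intro: order.trans [OF zero_le_one])
      \<comment> \<open>The norm estimate is applied with \<open>M = C * cmod (w - z)\<close>, which
        tends to 0.\<close>
      show "eventually (\<lambda>w. norm_minus 7 (?err w) \<le> C * cmod (w - z)) (at z)"
        using near by eventually_elim (rule norm_minus_7_le [OF supp bound], auto)
      show "((\<lambda>w. C * cmod (w - z)) \<longlongrightarrow> 0) (at z)"
        by (auto intro!: tendsto_eq_intros)
    qed auto
  qed simp
qed

end
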